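(* The sets of patterns $\{123,1121\}$, $\{132,1211\}$ and $\{213,1121\}$ are pairwise $m$-equivalent, that is, $\{123,1121\}\sim\{132,1211\}\sim\{213,1121\}$.
   Context: A (finite, reduced) multiset is $S=1^{a_1}2^{a_2}\cdots k^{a_k}$ with $k\ge 1$ and all $a_i\ge 1$, meaning that $i$ occurs with multiplicity $a_i$. A multipermutation of $S$ is a word having exactly $a_i$ occurrences of each letter $i\in[k]=\{1,\dots,k\}$ and no other letters. A word $\pi=\pi_1\cdots\pi_n$ contains a pattern (word) $\rho=\rho_1\cdots\rho_\ell$ if there are indices $i(1)<\cdots<i(\ell)$ such that for all $a,b\in[\ell]$: $\pi_{i(a)}<\pi_{i(b)}$ iff $\rho_a<\rho_b$, and $\pi_{i(a)}>\pi_{i(b)}$ iff $\rho_a>\rho_b$; otherwise $\pi$ avoids $\rho$. For a set $P$ of patterns, $\mathrm{av}(S;P)$ is the number of multipermutations of $S$ that avoid every pattern in $P$. Two sets of patterns $P,Q$ are $m$-equivalent, written here $P\sim Q$, if $\mathrm{av}(S;P)=\mathrm{av}(S;Q)$ for every multiset $S$. *)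

theory Defs
  imports "HOL-Combinatorics.Multiset_Permutations"
begin

text \<open>
  Words are lists over the positive integers (as \<^typ>\<open>nat\<close>); positions are counted from 0.
\<close>

text \<open>The multisets \<open>1^a_1 2^a_2 ... k^a_k\<close> with \<open>k \<ge> 1\<close> and all \<open>a_i \<ge> 1\<close>.\<close>

definition reduced_mset :: "nat multiset \<Rightarrow> bool" where
  "reduced_mset S \<longleftrightarrow> (\<exists>k\<ge>1. set_mset S = {1..k})"

definition contains_pattern :: "nat list \<Rightarrow> nat list \<Rightarrow> bool" where
  "contains_pattern \<pi> \<rho> \<longleftrightarrow>
     (\<exists>i :: nat \<Rightarrow> nat.
        strict_mono_on {..<length \<rho>} i \<and>
        (\<forall>a<length \<rho>. i a < length \<pi>) \<and>
        (\<forall>a<length \<rho>. \<forall>b<length \<rho>.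
           (\<pi> ! i a < \<pi> ! i b \<longleftrightarrow> \<rho> ! a < \<rho> ! b) \<and>
           (\<pi> ! i a > \<pi> ! i b \<longleftrightarrow> \<rho> ! a > \<rho> ! b)))"

abbreviation avoids_pattern :: "nat list \<Rightarrow> nat list \<Rightarrow> bool" where
  "avoids_pattern \<pi> \<rho> \<equiv> \<not> contains_pattern \<pi> \<rho>"

definition av :: "nat multiset \<Rightarrow> nat list set \<Rightarrow> nat" where
  "av S P = card {\<pi> \<in> permutations_of_multiset S. \<forall>\<rho>\<in>P. avoids_pattern \<pi> \<rho>}"

definition m_equivalent :: "nat list set \<Rightarrow> nat list set \<Rightarrow> bool" (infix "\<sim>\<^sub>m" 50) where
  "P \<sim>\<^sub>m Q \<longleftrightarrow> (\<forall>S. reduced_mset S \<longrightarrow> av S P = av S Q)"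

end

theory Submission
  imports Defs "HOL-Library.Sublist"
begin

text \<open>
  Build words by inserting the \<open>a\<close> copies of the smallest letter \<open>x\<close> into a word \<open>w\<close> over larger
  letters. Avoiding \<open>1121\<close> forces all copies of \<open>x\<close> but the first into a single gap of \<open>w\<close>, and
  avoiding \<open>1211\<close> forces all copies but the last into one. The pattern of length three then says
  that both gaps used are active: those preceding a weakly decreasing suffix (\<open>123\<close>), those
  preceding a weakly increasing suffix (\<open>132\<close>), or those where all earlier letters are at least as
  large as all later ones (\<open>213\<close>). If \<open>w\<close> has \<open>d + 1\<close> active gaps, the numbers of active gaps of
  the resulting words form a multiset that depends only on \<open>a\<close> and \<open>d\<close>, and it is the same
  multiset in all three cases. Hence the three generating trees agree.
\<close>

section \<open>Pattern containment and subsequences\<close>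

text \<open>Induction on the embedding of \<open>s\<close> into \<open>\<pi>\<close> produces a
  strictly increasing map of positions; the order relations of \<open>s\<close> then carry over to
  the letters at these positions.\<close>

lemma contains_patternI_subseq:
  assumes "subseq s \<pi>" "length s = length \<rho>"
    and "\<And>a b. a < length \<rho> \<Longrightarrow> b < length \<rho> \<Longrightarrow>
      (s ! a < s ! b \<longleftrightarrow> \<rho> ! a < \<rho> ! b) \<and> (s ! a > s ! b \<longleftrightarrow> \<rho> ! a > \<rho> ! b)"
  shows "contains_pattern \<pi> \<rho>"
proof -
  have "\<exists>i. strict_mono_on {..<length s} i \<and> (\<forall>a<length s. i a < length \<pi> \<and> \<pi> ! i a = s ! a)"
    using assms(1)
  proof (induction rule: list_emb.induct)
    case (list_emb_Nil ys)
    show ?case by (auto simp: strict_mono_on_def)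
  next
    case (list_emb_Cons xs ys y)
    then obtain i where "strict_mono_on {..<length xs} i"
      "\<forall>a<length xs. i a < length ys \<and> ys ! i a = xs ! a" by blast
    then show ?case
      by (intro exI[of _ "\<lambda>a. Suc (i a)"]) (auto simp: strict_mono_on_def)
  next
    case (list_emb_Cons2 x y xs ys)
    then obtain i where "strict_mono_on {..<length xs} i"
      "\<forall>a<length xs. i a < length ys \<and> ys ! i a = xs ! a" by blast
    \<comment> \<open>A matched head takes position 0 and all other positions move up by
      one.\<close>
    with list_emb_Cons2(1) show ?case
      by (intro exI[of _ "case_nat 0 (\<lambda>a. Suc (i a))"])
        (auto simp: strict_mono_on_def less_Suc_eq_0_disj nth_Cons split: nat.splits)
  qed
  then obtain i where "strict_mono_on {..<length s} i"
    "\<forall>a<length s. i a < length \<pi> \<and> \<pi> ! i a = s ! a" by blast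
  then show ?thesis
    unfolding contains_pattern_def using assms(2,3) by (intro exI[of _ i]) auto
qed

lemma subseq_map_nth:
  assumes "strict_mono_on {..<n} i" "\<forall>a<n. i a < length \<pi>"
  shows "subseq (map (\<lambda>a. \<pi> ! i a) [0..<n]) \<pi>"
proof -
  \<comment> \<open>The induction runs over prefixes: the first \<open>k\<close> chosen letters
    already embed into \<open>take m \<pi>\<close> once \<open>m\<close> exceeds their
    positions.\<close>
  have "\<forall>a<k. i a < m \<Longrightarrow> m \<le> length \<pi> \<Longrightarrow> subseq (map (\<lambda>a. \<pi> ! i a) [0..<k]) (take m \<pi>)"
    if "k \<le> n" for k m
    using that
  proof (induction k arbitrary: m)
    case (Suc k)
    have "\<forall>a<k. i a < i k"
      using assms(1) Suc.prems(3) by (auto simp: strict_mono_on_def)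
    with Suc have "subseq (map (\<lambda>a. \<pi> ! i a) [0..<k]) (take (i k) \<pi>)"
      by (meson Suc_leD lessI less_le_trans less_imp_le)
    then have "subseq (map (\<lambda>a. \<pi> ! i a) [0..<Suc k]) (take (Suc (i k)) \<pi>)"
      using Suc.prems by (auto simp: take_Suc_conv_app_nth intro!: list_emb_append_mono)
    also have "subseq (take (Suc (i k)) \<pi>) (take m \<pi>)"
      using Suc.prems(1) by (metis Suc_leI lessI min_absorb1 prefix_imp_subseq take_is_prefix take_take)
    finally show ?case .
  qed simp
  from this[of n "length \<pi>"] assms(2) show ?thesis by simp
qed

lemma contains_pattern_iff_subseq:
  "contains_pattern \<pi> \<rho> \<longleftrightarrow>
     (\<exists>s. subseq s \<pi> \<and> length s = length \<rho> \<and>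
       (\<forall>a<length \<rho>. \<forall>b<length \<rho>.
          (s ! a < s ! b \<longleftrightarrow> \<rho> ! a < \<rho> ! b) \<and> (s ! a > s ! b \<longleftrightarrow> \<rho> ! a > \<rho> ! b)))"
proof
  assume "contains_pattern \<pi> \<rho>"
  then obtain i where i: "strict_mono_on {..<length \<rho>} i" "\<forall>a<length \<rho>. i a < length \<pi>"
    "\<forall>a<length \<rho>. \<forall>b<length \<rho>. (\<pi> ! i a < \<pi> ! i b \<longleftrightarrow> \<rho> ! a < \<rho> ! b) \<and> (\<pi> ! i a > \<pi> ! i b \<longleftrightarrow> \<rho> ! a > \<rho> ! b)"
    unfolding contains_pattern_def by blast
  then show "\<exists>s. subseq s \<pi> \<and> length s = length \<rho> \<and>
       (\<forall>a<length \<rho>. \<forall>b<length \<rho>.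
          (s ! a < s ! b \<longleftrightarrow> \<rho> ! a < \<rho> ! b) \<and> (s ! a > s ! b \<longleftrightarrow> \<rho> ! a > \<rho> ! b))"
    using subseq_map_nth[of "length \<rho>" i \<pi>]
    by (intro exI[of _ "map (\<lambda>a. \<pi> ! i a) [0..<length \<rho>]"]) simp
qed (blast intro: contains_patternI_subseq)

section \<open>The five patterns as statements about subsequences\<close>

lemma contains_123: "contains_pattern \<pi> [1,2,3] \<longleftrightarrow> (\<exists>x y z. x < y \<and> y < z \<and> subseq [x,y,z] \<pi>)"
  unfolding contains_pattern_iff_subseq
  by (auto simp: All_less_Suc length_Suc_conv numeral_eq_Suc) (force+)?

lemma contains_132: "contains_pattern \<pi> [1,3,2] \<longleftrightarrow> (\<exists>x y z. x < y \<and> y < z \<and> subseq [x,z,y] \<pi>)"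
  unfolding contains_pattern_iff_subseq
  by (auto simp: All_less_Suc length_Suc_conv numeral_eq_Suc) (force+)?

lemma contains_213: "contains_pattern \<pi> [2,1,3] \<longleftrightarrow> (\<exists>x y z. x < y \<and> y < z \<and> subseq [y,x,z] \<pi>)"
  unfolding contains_pattern_iff_subseq
  by (auto simp: All_less_Suc length_Suc_conv numeral_eq_Suc) (force+)?

lemma contains_1121: "contains_pattern \<pi> [1,1,2,1] \<longleftrightarrow> (\<exists>x y. x < y \<and> subseq [x,x,y,x] \<pi>)"
  unfolding contains_pattern_iff_subseq
  by (auto simp: All_less_Suc length_Suc_conv numeral_eq_Suc) (metis linorder_neqE_nat | force)+

lemma contains_1211: "contains_pattern \<pi> [1,2,1,1] \<longleftrightarrow> (\<exists>x y. x < y \<and> subseq [x,y,x,x] \<pi>)"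
  unfolding contains_pattern_iff_subseq
  by (auto simp: All_less_Suc length_Suc_conv numeral_eq_Suc) (metis linorder_neqE_nat | force)+

section \<open>Elementary facts on subsequences\<close>

lemma subseq_set_mono: "subseq s u \<Longrightarrow> set s \<subseteq> set u"
  by (auto elim: list_emb_set)

lemma sorted_wrt_iff_subseq: "sorted_wrt R xs \<longleftrightarrow> (\<forall>y z. subseq [y, z] xs \<longrightarrow> R y z)"
proof (induction xs)
  case (Cons v vs)
  have "subseq [y, z] (v # vs) \<longleftrightarrow> (y = v \<and> z \<in> set vs) \<or> subseq [y, z] vs" for y z
    by (auto simp: subseq_singleton_left dest: subseq_set_mono)
  with Cons show ?case by auto
qed simp

lemma subseq_first_occurrence: "x \<notin> set u \<Longrightarrow> subseq (x # s) (u @ x # v) \<longleftrightarrow> subseq s v"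
  by (induction u) auto

lemma subseq_filter_neq: "x \<notin> set s \<Longrightarrow> subseq s (filter (\<lambda>y. y \<noteq> x) u) \<longleftrightarrow> subseq s u"
  by (metis (mono_tags, lifting) filter_True subseq_filter subseq_filter_left subseq_order.order_trans)

lemma subseq_rev_iff: "subseq (rev s) (rev u) \<longleftrightarrow> subseq s u"
proof -
  have "subseq s u \<Longrightarrow> subseq (rev s) (rev u)" for s u :: "'a list"
    by (induction rule: list_emb.induct) (auto intro: list_emb_append_mono)
  from this[of s u] this[of "rev s" "rev u"] show ?thesis by auto
qed

lemma subseq3_iff: "subseq [y, x, z] u \<longleftrightarrow> (\<exists>u1 u2. u = u1 @ x # u2 \<and> y \<in> set u1 \<and> z \<in> set u2)"
proof
  assume "subseq [y, x, z] u"
  then obtain u1 v1 where 1: "u = u1 @ y # v1" "subseq [x, z] v1"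
    using list_emb_ConsD[of "(=)" y "[x, z]" u] by auto
  then obtain u2 v2 where "v1 = u2 @ x # v2" "subseq [z] v2"
    using list_emb_ConsD[of "(=)" x "[z]" v1] by auto
  with 1 show "\<exists>u1 u2. u = u1 @ x # u2 \<and> y \<in> set u1 \<and> z \<in> set u2"
    by (intro exI[of _ "u1 @ y # u2"] exI[of _ v2]) (auto simp: subseq_singleton_left)
next
  assume "\<exists>u1 u2. u = u1 @ x # u2 \<and> y \<in> set u1 \<and> z \<in> set u2"
  then obtain u1 u2 where u: "u = u1 @ x # u2" "subseq [y] u1" "subseq [z] u2"
    by (auto simp: subseq_singleton_left)
  have "subseq ([y] @ x # [z]) (u1 @ x # u2)"
    by (rule list_emb_append_mono) (use u in auto)
  with u show "subseq [y, x, z] u" by simp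
qed

lemma subseq_append_notin: "x \<notin> set A \<Longrightarrow> subseq (x # s) (A @ B) \<longleftrightarrow> subseq (x # s) B"
  by (induction A) auto

text \<open>As \<open>A\<close> lacks \<open>x\<close>, the middle letter is matched in
  \<open>B\<close>; the only choice left is where \<open>y\<close> is matched.\<close>

lemma subseq3_append_notin:
  "x \<notin> set A \<Longrightarrow> subseq [y, x, z] (A @ B) \<Longrightarrow> y \<in> set A \<and> subseq [x, z] B \<or> subseq [y, x, z] B"
  by (induction A) (auto simp: subseq_append_notin split: if_splits)

text \<open>The letter \<open>y\<close> can only be matched behind the block, where no
  \<open>x\<close> remains.\<close>

lemma not_subseq_block:
  assumes "x \<noteq> y" "x \<notin> set w"
  shows "\<not> subseq [y, x] (replicate k x @ w)"
  using assms by (induction k) (auto dest: subseq_set_mono)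

section \<open>Inserting a smallest letter\<close>

text \<open>Two separate block sizes let one definition serve \<open>1121\<close>
  (\<open>b = 1\<close>) and \<open>1211\<close> (\<open>c = 1\<close>). Both \<open>p\<close> and
  \<open>q\<close> count letters of \<open>w\<close>, not of the result.\<close>

definition insert_letter :: "'a \<Rightarrow> nat \<Rightarrow> nat \<Rightarrow> nat \<Rightarrow> nat \<Rightarrow> 'a list \<Rightarrow> 'a list" where
  "insert_letter x b c p q w =
     take p w @ replicate b x @ take (q - p) (drop p w) @ replicate c x @ drop q w"

lemma take_take_drop_drop: "p \<le> q \<Longrightarrow> take p w @ take (q - p) (drop p w) @ drop q w = w"
  by (metis append.assoc append_take_drop_id le_add_diff_inverse take_add)

lemma notin_parts: "x \<notin> set w \<Longrightarrow> x \<notin> set (take p w) \<and> x \<notin> set (take r (drop p w)) \<and> x \<notin> set (drop q w)"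
  by (meson in_set_dropD in_set_takeD)

lemma set_take_le: "p \<le> q \<Longrightarrow> set (take q w) = set (take p w) \<union> set (take (q - p) (drop p w))"
  by (metis le_add_diff_inverse set_append take_add)

lemma set_drop_le: "p \<le> q \<Longrightarrow> set (drop p w) = set (take (q - p) (drop p w)) \<union> set (drop q w)"
  by (metis append_take_drop_id drop_drop le_add_diff_inverse2 set_append)

lemma filter_insert_letter:
  assumes "x \<notin> set w" "p \<le> q"
  shows "filter (\<lambda>y. y \<noteq> x) (insert_letter x b c p q w) = w"
proof -
  have [simp]: "filter (\<lambda>y. y \<noteq> x) v = v" if "x \<notin> set v" for v
    using that by (auto intro: filter_True)
  show ?thesis
    using notin_parts[OF assms(1)] take_take_drop_drop[OF assms(2), of w]
    by (simp add: insert_letter_def filter_replicate)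
qed

lemma mset_insert_letter:
  "p \<le> q \<Longrightarrow> mset (insert_letter x b c p q w) = mset w + replicate_mset (b + c) x"
  using arg_cong[OF take_take_drop_drop[of p q w], of mset]
  by (simp add: insert_letter_def multiset_eq_iff)

lemma length_insert_letter:
  "p \<le> q \<Longrightarrow> length (insert_letter x b c p q w) = length w + b + c"
  using mset_insert_letter[of p q x b c w] by (metis add.assoc size_mset size_replicate_mset size_union)

lemma rev_insert_letter:
  assumes "p \<le> q" "q \<le> length w"
  shows "rev (insert_letter x b c p q w) = insert_letter x c b (length w - q) (length w - p) (rev w)"
proof -
  have "length w - p - (length w - q) = q - p" using assms by simp
  moreover from this have "min (length w - p) (q - p) = q - p" using assms by simp
  ultimately show ?thesis
    using assms by (simp add: insert_letter_def rev_take rev_drop drop_take)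
qed

text \<open>The first \<open>x\<close> follows exactly \<open>p\<close> letters of \<open>w\<close>.
  If the first block is empty, this \<open>x\<close> belongs to the second one, hence the demand
  \<open>p = q\<close>.\<close>

lemma length_takeWhile_insert_letter:
  assumes "x \<notin> set w" "p \<le> q" "q \<le> length w" "0 < b \<or> p = q \<and> 0 < c"
  shows "length (takeWhile (\<lambda>y. y \<noteq> x) (insert_letter x b c p q w)) = p"
proof -
  obtain v where "insert_letter x b c p q w = take p w @ x # v"
    using assms(4) by (cases b; cases c) (auto simp: insert_letter_def)
  moreover have "takeWhile (\<lambda>y. y \<noteq> x) (take p w @ x # v) = take p w"
    using notin_parts[OF assms(1)] by (subst takeWhile_append2) auto
  ultimately show ?thesis using assms by simp
qed

text \<open>Deleting \<open>x\<close> recovers \<open>w\<close>, the first \<open>x\<close> locates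
  \<open>p\<close>, and the last \<open>x\<close>, found as the first one of the reversed word,
  locates \<open>q\<close>.\<close>

lemma insert_letter_inject:
  assumes "x \<notin> set w" "p \<le> q" "q \<le> length w"
    and "x \<notin> set w'" "p' \<le> q'" "q' \<le> length w'"
    and "(0 < b \<and> 0 < c) \<or> (0 < b + c \<and> p = q \<and> p' = q')"
    and eq: "insert_letter x b c p q w = insert_letter x b c p' q' w'"
  shows "w = w' \<and> p = p' \<and> q = q'"
proof -
  have w: "w = w'"
    using eq filter_insert_letter[of x w p q b c] filter_insert_letter[of x w' p' q' b c] assms by simp
  have "p = p'"
    using eq length_takeWhile_insert_letter[of x w p q b c]
      length_takeWhile_insert_letter[of x w' p' q' b c] assms by auto
  moreover have "insert_letter x c b (length w - q) (length w - p) (rev w) =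
      insert_letter x c b (length w' - q') (length w' - p') (rev w')"
    using eq assms(2,3,5,6) by (metis rev_insert_letter)
  then have "length w - q = length w' - q'"
    using length_takeWhile_insert_letter[of x "rev w" "length w - q" "length w - p" c b]
      length_takeWhile_insert_letter[of x "rev w'" "length w' - q'" "length w' - p'" c b] assms
    by auto
  ultimately show ?thesis using w assms by auto
qed

lemma larger_after_block:
  fixes x :: nat
  assumes "\<forall>y\<in>set r. x \<le> y" "\<forall>y>x. \<not> subseq [y, x] r"
  shows "\<exists>k w. r = replicate k x @ w \<and> x \<notin> set w"
  using assms
proof (induction r)
  case (Cons z r)
  show ?case
  proof (cases "z = x")
    case True
    with Cons have "\<exists>k w. r = replicate k x @ w \<and> x \<notin> set w"
      by (auto split: if_splits)
    then obtain k w where "r = replicate k x @ w" "x \<notin> set w" by blast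
    with True show ?thesis by (intro exI[of _ "Suc k"]) auto
  next
    case False
    with Cons.prems have "x < z" by auto
    with Cons.prems(2) have "x \<notin> set r"
      using subseq_singleton_left[of x r] by (auto dest!: spec[of _ z])
    with False show ?thesis by (intro exI[of _ 0]) auto
  qed
qed auto

text \<open>Behind the second copy of \<open>x\<close> no larger letter may be followed by
  \<open>x\<close>, so from the second copy on the copies are contiguous, while the first may stand
  apart. Gap \<open>p\<close> holds the first copy, gap \<open>q\<close> the block.\<close>

lemma avoids_1121_iff:
  fixes x :: nat
  assumes "\<forall>y\<in>set u. x \<le> y" "x \<in> set u"
  defines "w \<equiv> filter (\<lambda>y. y \<noteq> x) u" and "a \<equiv> count (mset u) x"
  shows "(\<forall>y>x. \<not> subseq [x, x, y, x] u) \<longleftrightarrow>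
    (\<exists>p q. p \<le> q \<and> q \<le> length w \<and> (a = 1 \<longrightarrow> p = q) \<and> u = insert_letter x 1 (a - 1) p q w)"
    (is "?L \<longleftrightarrow> ?R")
proof
  assume L: ?L
  have [simp]: "filter (\<lambda>y. y \<noteq> x) v = v" if "x \<notin> set v" for v
    using that by (auto intro: filter_True)
  have [simp]: "count (mset v) x = 0" if "x \<notin> set v" for v
    using that by (simp add: count_eq_zero_iff)
  obtain w1 r where u: "u = w1 @ x # r" "x \<notin> set w1"
    using split_list_first[OF assms(2)] by blast
  show ?R
  proof (cases "x \<in> set r")
    case False
    with u have "w = w1 @ r" "a = 1" by (auto simp: w_def a_def)
    with u show ?thesis
      by (intro exI[of _ "length w1"]) (auto simp: insert_letter_def)
  next
    case True
    then obtain w2 r' where r: "r = w2 @ x # r'" "x \<notin> set w2"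
      using split_list_first[OF True] by blast
    with u L have "\<forall>y>x. \<not> subseq [y, x] r'"
      by (auto simp: subseq_first_occurrence)
    moreover have "\<forall>y\<in>set r'. x \<le> y" using assms(1) u r by auto
    ultimately obtain k w3 where r': "r' = replicate k x @ w3" "x \<notin> set w3"
      using larger_after_block by blast
    with u r have "w = w1 @ w2 @ w3" "a = Suc (Suc k)"
      by (auto simp: w_def a_def filter_replicate)
    \<comment> \<open>The second gap comes after \<open>w1 @ w2\<close>; since
      \<open>a = k + 2\<close>, it holds \<open>k + 1\<close> copies.\<close>
    with u r r' show ?thesis
      by (intro exI[of _ "length w1"] exI[of _ "length w1 + length w2"]) (auto simp: insert_letter_def)
  qed
next
  assume ?R
  then obtain p q where pq: "p \<le> q" "u = insert_letter x 1 (a - 1) p q w" by blast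
  have no: "x \<notin> set w" by (auto simp: w_def)
  note parts = notin_parts[OF this]
  have block: "\<not> subseq [y, x] (replicate k x @ drop q w)" if "x < y" for k y
    using that parts by (intro not_subseq_block) auto
  have "\<not> subseq [x, x, y, x] u" if "x < y" for y
  proof -
    have "subseq [x, x, y, x] u \<longleftrightarrow> subseq [x, y, x] (take (q - p) (drop p w) @ replicate (a - 1) x @ drop q w)"
      using parts pq(2) by (simp add: insert_letter_def subseq_first_occurrence)
    also have "\<not> \<dots>"
    proof (cases "a - 1")
      case 0
      then show ?thesis using parts by (auto dest!: subseq_set_mono)
    next
      case (Suc k)
      then show ?thesis using parts block[OF that, of k] by (simp add: subseq_first_occurrence)
    qed
    finally show ?thesis .
  qed
  then show ?L by blast
qed

text \<open>Reversal exchanges the two patterns and sends gap \<open>r\<close> to gap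
  \<open>length w - r\<close>, so the block of \<open>a - 1\<close> copies moves to the left
  gap.\<close>

lemma avoids_1211_iff:
  fixes x :: nat
  assumes "\<forall>y\<in>set u. x \<le> y" "x \<in> set u"
  defines "w \<equiv> filter (\<lambda>y. y \<noteq> x) u" and "a \<equiv> count (mset u) x"
  shows "(\<forall>y>x. \<not> subseq [x, y, x, x] u) \<longleftrightarrow>
    (\<exists>p q. p \<le> q \<and> q \<le> length w \<and> (a = 1 \<longrightarrow> p = q) \<and> u = insert_letter x (a - 1) 1 p q w)"
    (is "_ \<longleftrightarrow> ?R")
proof -
  have "(\<forall>y>x. \<not> subseq [x, y, x, x] u) \<longleftrightarrow> (\<forall>y>x. \<not> subseq [x, x, y, x] (rev u))"
    using subseq_rev_iff[of "[x, _, x, x]" u] by simp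
  also have "\<dots> \<longleftrightarrow> (\<exists>p q. p \<le> q \<and> q \<le> length w \<and> (a = 1 \<longrightarrow> p = q) \<and>
      rev u = insert_letter x 1 (a - 1) p q (rev w))" (is "_ \<longleftrightarrow> ?Q")
    using avoids_1121_iff[of "rev u" x] assms by (simp flip: rev_filter)
  also have "?Q \<longleftrightarrow> ?R"
  proof
    assume ?Q
    then obtain p q where *: "p \<le> q" "q \<le> length w" "a = 1 \<longrightarrow> p = q"
      "rev u = insert_letter x 1 (a - 1) p q (rev w)" by blast
    have "u = insert_letter x (a - 1) 1 (length w - q) (length w - p) w"
      using arg_cong[OF *(4), of rev] *(1-3) by (simp add: rev_insert_letter)
    with * show ?R by (intro exI[of _ "length w - q"] exI[of _ "length w - p"]) auto
  next
    assume ?R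
    then obtain p q where *: "p \<le> q" "q \<le> length w" "a = 1 \<longrightarrow> p = q"
      "u = insert_letter x (a - 1) 1 p q w" by blast
    have "rev u = insert_letter x 1 (a - 1) (length w - q) (length w - p) (rev w)"
      using arg_cong[OF *(4), of rev] *(1-3) by (simp add: rev_insert_letter)
    with * show ?Q by (intro exI[of _ "length w - q"] exI[of _ "length w - p"]) auto
  qed
  finally show ?thesis .
qed

section \<open>Generating trees\<close>

text \<open>A single copy occupies a single gap; forcing \<open>p = q\<close> for
  \<open>a = 1\<close> keeps the encoding of an insertion unique.\<close>

definition slot_pairs :: "nat set \<Rightarrow> nat \<Rightarrow> (nat \<times> nat) set" where
  "slot_pairs A a = {(p, q). p \<in> A \<and> q \<in> A \<and> p \<le> q \<and> (a = 1 \<longrightarrow> p = q)}"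

text \<open>
  \<open>(g, h)\<close> are the ranks, counted from 0, of the two chosen gaps among the \<open>d + 1\<close> active ones, and
  the conditional is one less than the resulting number of active gaps in the \<open>213\<close> case. The
  other two classes are matched to it by explicit bijections.
\<close>

definition slot_count :: "nat \<Rightarrow> nat \<Rightarrow> nat \<Rightarrow> nat" where
  "slot_count a d e = card {(g, h). g \<le> h \<and> h \<le> d \<and> (a = 1 \<longrightarrow> g = h) \<and> (if h < d then Suc g else g + a) = e}"

text \<open>The growth rule shared by the three classes: \<open>b a\<close> copies enter the left
  gap and \<open>c a\<close> the right one. \<open>pos_bc\<close> makes both gaps readable from the
  word. \<open>card_children\<close> prescribes the distribution of the numbers of active gaps among
  the children, through the same \<open>slot_count\<close> in every instance.\<close>

locale min_insertion =
  fixes Av :: "nat list \<Rightarrow> bool" and slots :: "nat list \<Rightarrow> nat set" and b c :: "nat \<Rightarrow> nat"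
  assumes Av_Nil: "Av []"
    and slots_le: "slots w \<subseteq> {..length w}"
    and slots_Nil: "slots [] = {0}"
    and sum_bc: "0 < a \<Longrightarrow> b a + c a = a"
    and pos_bc: "1 < a \<Longrightarrow> 0 < b a \<and> 0 < c a"
    and Av_iff: "\<And>u x w a. \<lbrakk>\<forall>y\<in>set u. x \<le> y; x \<in> set u; w = filter (\<lambda>y. y \<noteq> x) u; a = count (mset u) x\<rbrakk> \<Longrightarrow>
      Av u \<longleftrightarrow> Av w \<and> (\<exists>p q. (p, q) \<in> slot_pairs (slots w) a \<and> u = insert_letter x (b a) (c a) p q w)"
    and card_children: "\<And>w x a e. \<lbrakk>\<forall>y\<in>set w. x < y; 0 < a\<rbrakk> \<Longrightarrow>
      card {(p, q) \<in> slot_pairs (slots w) a. card (slots (insert_letter x (b a) (c a) p q w)) - 1 = e} =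
        slot_count a (card (slots w) - 1) e"
begin

definition avoiders :: "nat multiset \<Rightarrow> nat list set" where
  "avoiders S = {u \<in> permutations_of_multiset S. Av u}"

definition statistic :: "nat multiset \<Rightarrow> nat multiset" where
  "statistic S = image_mset (\<lambda>u. card (slots u) - 1) (mset_set (avoiders S))"

lemma finite_avoiders: "finite (avoiders S)"
  by (simp add: avoiders_def)

lemma size_statistic: "size (statistic S) = card (avoiders S)"
  by (simp add: statistic_def)

lemma finite_slot_pairs: "finite (slot_pairs (slots w) a)"
  by (rule finite_subset[of _ "{..length w} \<times> {..length w}"]) (use slots_le in \<open>auto simp: slot_pairs_def\<close>)

lemma statistic_empty: "statistic {#} = {#0#}"
proof -
  have "avoiders {#} = {[]}" using Av_Nil by (auto simp: avoiders_def)
  then show ?thesis by (simp add: statistic_def slots_Nil)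
qed

text \<open>Each avoider of the larger multiset arises exactly once:
  \<open>insert_letter_inject\<close> gives injectivity, and the two directions of
  \<open>Av_iff\<close> give membership and surjectivity.\<close>

lemma avoiders_add_min:
  assumes less: "\<forall>y\<in>#S. x < y" and a: "0 < a"
  defines "ins \<equiv> \<lambda>(w, p, q). insert_letter x (b a) (c a) p q w"
  shows "bij_betw ins (Sigma (avoiders S) (\<lambda>w. slot_pairs (slots w) a))
           (avoiders (S + replicate_mset a x))"
proof (intro bij_betwI' )
  have notin: "x \<notin> set w" if "w \<in> avoiders S" for w
    using that less by (force simp: avoiders_def permutations_of_multiset_def simp flip: set_mset_mset)
  have bound: "p \<le> q \<and> q \<le> length w" if "(p, q) \<in> slot_pairs (slots w) a" for p q w
    using that slots_le by (auto simp: slot_pairs_def)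
  {
    fix s t
    assume s: "s \<in> Sigma (avoiders S) (\<lambda>w. slot_pairs (slots w) a)"
      and t: "t \<in> Sigma (avoiders S) (\<lambda>w. slot_pairs (slots w) a)"
    obtain w p q w' p' q' where st: "s = (w, p, q)" "t = (w', p', q')" by (cases s; cases t) auto
    \<comment> \<open>For \<open>a = 1\<close> one block is empty, but then
      \<open>slot_pairs\<close> makes the two gaps equal.\<close>
    have "(0 < b a \<and> 0 < c a) \<or> (0 < b a + c a \<and> p = q \<and> p' = q')"
      using s t st a sum_bc[OF a] pos_bc[of a] by (cases "a = 1") (auto simp: slot_pairs_def)
    then show "ins s = ins t \<longleftrightarrow> s = t"
      using insert_letter_inject[of x w p q w' p' q' "b a" "c a"] s t st bound notin
      by (auto simp: ins_def)
  next
    fix s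
    assume s: "s \<in> Sigma (avoiders S) (\<lambda>w. slot_pairs (slots w) a)"
    obtain w p q where st: "s = (w, p, q)" by (cases s) auto
    define u where "u = insert_letter x (b a) (c a) p q w"
    have w: "w \<in> avoiders S" "(p, q) \<in> slot_pairs (slots w) a" using s st by auto
    then have m: "mset u = S + replicate_mset a x"
      using bound[of p q w] sum_bc[OF a]
      by (auto simp: u_def mset_insert_letter avoiders_def permutations_of_multiset_def)
    have f: "w = filter (\<lambda>y. y \<noteq> x) u"
      using filter_insert_letter[of x w p q] notin[OF w(1)] bound[OF w(2)] by (simp add: u_def)
    have set_u: "set u = set_mset S \<union> {x}" using m a by (simp flip: set_mset_mset)
    have "count (mset u) x = a" using less by (auto simp: m count_eq_zero_iff)
    then have "Av u \<longleftrightarrow> Av w \<and> (\<exists>p q. (p, q) \<in> slot_pairs (slots w) a \<and> u = insert_letter x (b a) (c a) p q w)"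
      using set_u less by (intro Av_iff[OF _ _ f]) (auto intro: less_imp_le)
    moreover have "Av w" using w(1) by (simp add: avoiders_def)
    ultimately have "Av u" using w(2) u_def by blast
    with m show "ins s \<in> avoiders (S + replicate_mset a x)"
      by (auto simp: avoiders_def permutations_of_multiset_def st ins_def u_def)
  next
    fix u
    assume u: "u \<in> avoiders (S + replicate_mset a x)"
    then have m: "mset u = S + replicate_mset a x" by (auto simp: avoiders_def permutations_of_multiset_def)
    then have set_u: "set u = set_mset S \<union> {x}" using a by (simp flip: set_mset_mset)
    have cnt: "count (mset u) x = a" using less by (auto simp: m count_eq_zero_iff)
    define w where "w = filter (\<lambda>y. y \<noteq> x) u"
    have "mset w = filter_mset (\<lambda>y. y \<noteq> x) (mset u)" by (simp add: w_def)
    also have "\<dots> = S"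
      using less unfolding m by (auto simp: multiset_eq_iff count_eq_zero_iff)
    finally have mw: "mset w = S" .
    have "Av u \<longleftrightarrow> Av w \<and> (\<exists>p q. (p, q) \<in> slot_pairs (slots w) a \<and> u = insert_letter x (b a) (c a) p q w)"
      using set_u less cnt by (intro Av_iff[OF _ _ w_def]) (auto intro: less_imp_le)
    moreover have "Av u" using u by (simp add: avoiders_def)
    ultimately obtain p q where "Av w" "(p, q) \<in> slot_pairs (slots w) a" "u = insert_letter x (b a) (c a) p q w"
      by blast
    with mw show "\<exists>s\<in>Sigma (avoiders S) (\<lambda>w. slot_pairs (slots w) a). u = ins s"
      by (intro bexI[of _ "(w, p, q)"]) (auto simp: ins_def avoiders_def permutations_of_multiset_def)
  }
qed

text \<open>Children are grouped by parent, and a parent enters only through its number of active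
  gaps. Hence the new statistic depends only on \<open>a\<close> and the statistic of
  \<open>S\<close>.\<close>

lemma count_statistic_add_min:
  assumes "\<forall>y\<in>#S. x < y" and a: "0 < a"
  shows "count (statistic (S + replicate_mset a x)) e = (\<Sum>d\<in>#statistic S. slot_count a d e)"
proof -
  define ins where "ins = (\<lambda>(w, p, q). insert_letter x (b a) (c a) p q w)"
  define st where "st = (\<lambda>u. card (slots u) - 1)"
  let ?P = "Sigma (avoiders S) (\<lambda>w. slot_pairs (slots w) a)"
  let ?Q = "Sigma (avoiders S) (\<lambda>w. {(p, q) \<in> slot_pairs (slots w) a. st (ins (w, p, q)) = e})"
  have bij: "bij_betw ins ?P (avoiders (S + replicate_mset a x))"
    using avoiders_add_min[OF assms] by (simp add: ins_def)
  have "count (statistic (S + replicate_mset a x)) e = card {u \<in> avoiders (S + replicate_mset a x). st u = e}"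
    by (simp add: statistic_def st_def count_image_mset finite_avoiders vimage_def Int_def conj_commute)
  also have "\<dots> = card ?Q"
  proof (rule bij_betw_same_card[symmetric])
    have "ins ` ?Q = {u \<in> avoiders (S + replicate_mset a x). st u = e}"
      using bij by (fastforce simp: bij_betw_def)
    then show "bij_betw ins ?Q {u \<in> avoiders (S + replicate_mset a x). st u = e}"
      by (intro bij_betw_subset[OF bij]) auto
  qed
  also have "\<dots> = (\<Sum>w\<in>avoiders S. card {(p, q) \<in> slot_pairs (slots w) a. st (ins (w, p, q)) = e})"
    by (rule card_SigmaI) (auto simp: finite_avoiders intro: finite_subset[OF _ finite_slot_pairs])
  also have "\<dots> = (\<Sum>w\<in>avoiders S. slot_count a (st w) e)"
  proof (rule sum.cong)
    fix w assume "w \<in> avoiders S"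
    then have "\<forall>y\<in>set w. x < y"
      using assms(1) by (auto simp: avoiders_def permutations_of_multiset_def)
    from card_children[OF this a, of e]
    show "card {(p, q) \<in> slot_pairs (slots w) a. st (ins (w, p, q)) = e} = slot_count a (st w) e"
      by (simp add: st_def ins_def)
  qed simp
  also have "\<dots> = (\<Sum>d\<in>#statistic S. slot_count a d e)"
    by (simp add: statistic_def st_def sum_unfold_sum_mset multiset.map_comp comp_def)
  finally show ?thesis .
qed

end

text \<open>Cardinalities alone do not determine the next level of the tree, so the induction
  compares whole statistics, removing all copies of the smallest letter at each step.\<close>

lemma min_insertion_card_avoiders_eq:
  assumes "min_insertion Av slots b c" "min_insertion Av' slots' b' c'"
  shows "card (min_insertion.avoiders Av S) = card (min_insertion.avoiders Av' S)"
proof -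
  interpret A: min_insertion Av slots b c by fact
  interpret B: min_insertion Av' slots' b' c' by fact
  have "A.statistic S = B.statistic S"
  proof (induction "card (set_mset S)" arbitrary: S)
    case 0
    then show ?case by (simp add: A.statistic_empty B.statistic_empty)
  next
    case (Suc k)
    define x where "x = Min (set_mset S)"
    define T where "T = filter_mset (\<lambda>y. y \<noteq> x) S"
    have "set_mset S \<noteq> {}" using Suc(2) by auto
    then have x: "x \<in># S" "\<forall>y\<in>#S. x \<le> y" by (auto simp: x_def)
    have S: "S = T + replicate_mset (count S x) x"
      by (auto simp: T_def multiset_eq_iff)
    have "set_mset T = set_mset S - {x}" by (auto simp: T_def)
    then have "k = card (set_mset T)" using Suc(2) x(1) by simp
    with Suc(1) have T: "A.statistic T = B.statistic T" by blast
    have less: "\<forall>y\<in>#T. x < y" using x by (auto simp: T_def le_neq_trans)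
    show ?case
      using A.count_statistic_add_min[OF less, of "count S x"] B.count_statistic_add_min[OF less, of "count S x"]
        x(1) T S by (intro multiset_eqI) simp
  qed
  then show ?thesis using A.size_statistic[of S] B.size_statistic[of S] by simp
qed

section \<open>The three classes\<close>

text \<open>This serves \<open>123\<close>, with active gaps \<open>m..n\<close>. The gaps before
  \<open>n\<close> are reflected onto the ranks below \<open>n - m\<close>, which reverses their
  order, while the end gap \<open>n\<close> keeps the top rank \<open>n - m\<close>.\<close>

lemma slot_count_weakly_decreasing:
  assumes "m \<le> n" "0 < a"
  shows "card {(p, q). m \<le> p \<and> p \<le> q \<and> q \<le> n \<and> (a = 1 \<longrightarrow> p = q) \<and>
      (if q < n then n - q else if p < n then n - p + a - 1 else n - m + a) = e} = slot_count a (n - m) e"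
  unfolding slot_count_def
proof (rule bij_betw_same_card)
  let ?S = "{(p, q). m \<le> p \<and> p \<le> q \<and> q \<le> n \<and> (a = 1 \<longrightarrow> p = q) \<and>
      (if q < n then n - q else if p < n then n - p + a - 1 else n - m + a) = e}"
  let ?T = "{(g, h). g \<le> h \<and> h \<le> n - m \<and> (a = 1 \<longrightarrow> g = h) \<and> (if h < n - m then Suc g else g + a) = e}"
  let ?f = "\<lambda>(p, q). if p = n then (n - m, n - m) else if q = n then (n - p - 1, n - m)
    else (n - q - 1, n - p - 1)"
  let ?g = "\<lambda>(g, h). if g = n - m then (n, n) else if h = n - m then (n - g - 1, n)
    else (n - h - 1, n - g - 1)"
  show "bij_betw ?f ?S ?T"
    by (rule bij_betw_byWitness[where f' = ?g]) (use assms in \<open>auto split: if_splits\<close>)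
qed

text \<open>This serves \<open>132\<close>. For \<open>a > 1\<close>, pairs with
  \<open>p < q\<close> fill the rank pairs with \<open>h < n - m\<close>, the shift by one absorbing
  strictness, and pairs with \<open>p = q\<close> fill those with \<open>h = n - m\<close>. For
  \<open>a = 1\<close> both branches of \<open>slot_count\<close> agree and the diagonal is
  reflected.\<close>

lemma slot_count_weakly_increasing:
  assumes "m \<le> n" "0 < a"
  shows "card {(p, q). m \<le> p \<and> p \<le> q \<and> q \<le> n \<and> (a = 1 \<longrightarrow> p = q) \<and>
      (if p < q then n - q + 1 else n - p + a) = e} = slot_count a (n - m) e"
  unfolding slot_count_def
proof (rule bij_betw_same_card)
  let ?S = "{(p, q). m \<le> p \<and> p \<le> q \<and> q \<le> n \<and> (a = 1 \<longrightarrow> p = q) \<and>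
      (if p < q then n - q + 1 else n - p + a) = e}"
  let ?T = "{(g, h). g \<le> h \<and> h \<le> n - m \<and> (a = 1 \<longrightarrow> g = h) \<and> (if h < n - m then Suc g else g + a) = e}"
  let ?f = "\<lambda>(p, q). if p < q then (n - q, n - p - 1) else if a = 1 then (n - p, n - p) else (n - p, n - m)"
  let ?g = "\<lambda>(g, h). if a = 1 \<or> h = n - m then (n - g, n - g) else (n - h - 1, n - g)"
  show "bij_betw ?f ?S ?T"
    by (rule bij_betw_byWitness[where f' = ?g]) (use assms in \<open>auto split: if_splits\<close>)
qed

section \<open>Gaps that precede a sorted suffix\<close>

definition suffix_slots :: "('a \<Rightarrow> 'a \<Rightarrow> bool) \<Rightarrow> 'a list \<Rightarrow> nat set" where
  "suffix_slots R w = {p. p \<le> length w \<and> sorted_wrt R (drop p w)}"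

lemma sorted_wrt_drop_mono: "sorted_wrt R (drop p w) \<Longrightarrow> p \<le> q \<Longrightarrow> sorted_wrt R (drop q w)"
  by (metis drop_drop le_add_diff_inverse2 sorted_wrt_drop)

text \<open>Sortedness passes to shorter suffixes, so the active gaps form an interval reaching to
  the end, and failure just before \<open>m\<close> fixes its start.\<close>

lemma suffix_slots_eq_atLeastAtMostI:
  assumes "sorted_wrt R (drop m u)" "0 < m \<Longrightarrow> \<not> sorted_wrt R (drop (m - 1) u)"
  shows "suffix_slots R u = {m..length u}"
proof -
  have "m \<le> p" if "sorted_wrt R (drop p u)" for p
  proof (rule ccontr)
    assume "\<not> m \<le> p"
    then have "0 < m" "p \<le> m - 1" by linarith+
    then show False using assms(2) sorted_wrt_drop_mono[OF that] by blast
  qed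
  then show ?thesis
    using sorted_wrt_drop_mono[OF assms(1)] by (auto simp: suffix_slots_def)
qed

lemma suffix_slots_eq_atLeastAtMost:
  obtains m where "m \<le> length w" "suffix_slots R w = {m..length w}"
    "sorted_wrt R (drop m w)" "0 < m \<Longrightarrow> \<not> sorted_wrt R (drop (m - 1) w)"
proof -
  define m where "m = (LEAST p. sorted_wrt R (drop p w))"
  have 1: "sorted_wrt R (drop (length w) w)" by simp
  have "sorted_wrt R (drop m w)" "m \<le> length w"
    unfolding m_def by (rule LeastI[where P = "\<lambda>p. sorted_wrt R (drop p w)", OF 1],
        rule Least_le[where P = "\<lambda>p. sorted_wrt R (drop p w)", OF 1])
  moreover have "\<not> sorted_wrt R (drop (m - 1) w)" if "0 < m"
    using not_less_Least[of "m - 1" "\<lambda>p. sorted_wrt R (drop p w)"] that by (auto simp: m_def)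
  ultimately show thesis using that suffix_slots_eq_atLeastAtMostI[of R m w] by blast
qed


section \<open>Occurrences that use the smallest letter\<close>

lemma subseq_neq_iff:
  assumes "w = filter (\<lambda>y. y \<noteq> x) u" "x \<notin> set s"
  shows "subseq s w \<longleftrightarrow> subseq s u"
  using assms subseq_filter_neq by metis

text \<open>If the least letter of an occurrence is not \<open>x\<close>, all its letters exceed
  \<open>x\<close> and it survives in \<open>w\<close>. What remains are the occurrences with
  \<open>x\<close> in the role of \<open>1\<close>.\<close>

lemma avoids_min_iff:
  fixes x :: nat
  assumes "\<forall>y\<in>set u. x \<le> y" and w: "w = filter (\<lambda>y. y \<noteq> x) u"
  shows "avoids_pattern u [1,2,3] \<longleftrightarrow>
      avoids_pattern w [1,2,3] \<and> (\<forall>y z. x < y \<and> y < z \<longrightarrow> \<not> subseq [x,y,z] u)"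
    and "avoids_pattern u [1,3,2] \<longleftrightarrow>
      avoids_pattern w [1,3,2] \<and> (\<forall>y z. x < y \<and> y < z \<longrightarrow> \<not> subseq [x,z,y] u)"
    and "avoids_pattern u [2,1,3] \<longleftrightarrow>
      avoids_pattern w [2,1,3] \<and> (\<forall>y z. x < y \<and> y < z \<longrightarrow> \<not> subseq [y,x,z] u)"
    and "avoids_pattern u [1,1,2,1] \<longleftrightarrow>
      avoids_pattern w [1,1,2,1] \<and> (\<forall>y>x. \<not> subseq [x,x,y,x] u)"
    and "avoids_pattern u [1,2,1,1] \<longleftrightarrow>
      avoids_pattern w [1,2,1,1] \<and> (\<forall>y>x. \<not> subseq [x,y,x,x] u)"
proof -
  have le: "x \<le> v" if "v \<in> set s" "subseq s u" for s v
    using that subseq_set_mono[of s u] assms(1) by auto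
  have sub: "subseq s u" if "subseq s w" for s
    using that unfolding w by (meson subseq_filter_left subseq_order.order_trans)
  have neq: "subseq s w" if "x \<notin> set s" "subseq s u" for s
    using that subseq_neq_iff[OF w] by blast
  show "avoids_pattern u [1,2,3] \<longleftrightarrow>
      avoids_pattern w [1,2,3] \<and> (\<forall>y z. x < y \<and> y < z \<longrightarrow> \<not> subseq [x,y,z] u)"
  proof -
    have "subseq [x',y,z] w" if "subseq [x',y,z] u" "x' \<noteq> x" "x' < y" "y < z" for x' y z
      using that le[of x' "[x',y,z]"] neq[of "[x',y,z]"] by auto
    then show ?thesis unfolding contains_123 using sub by metis
  qed
  show "avoids_pattern u [1,3,2] \<longleftrightarrow>
      avoids_pattern w [1,3,2] \<and> (\<forall>y z. x < y \<and> y < z \<longrightarrow> \<not> subseq [x,z,y] u)"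
  proof -
    have "subseq [x',z,y] w" if "subseq [x',z,y] u" "x' \<noteq> x" "x' < y" "y < z" for x' y z
      using that le[of x' "[x',z,y]"] neq[of "[x',z,y]"] by auto
    then show ?thesis unfolding contains_132 using sub by metis
  qed
  show "avoids_pattern u [2,1,3] \<longleftrightarrow>
      avoids_pattern w [2,1,3] \<and> (\<forall>y z. x < y \<and> y < z \<longrightarrow> \<not> subseq [y,x,z] u)"
  proof -
    have "subseq [y,x',z] w" if "subseq [y,x',z] u" "x' \<noteq> x" "x' < y" "y < z" for x' y z
      using that le[of x' "[y,x',z]"] neq[of "[y,x',z]"] by auto
    then show ?thesis unfolding contains_213 using sub by metis
  qed
  show "avoids_pattern u [1,1,2,1] \<longleftrightarrow>
      avoids_pattern w [1,1,2,1] \<and> (\<forall>y>x. \<not> subseq [x,x,y,x] u)"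
  proof -
    have "subseq [x',x',y,x'] w" if "subseq [x',x',y,x'] u" "x' \<noteq> x" "x' < y" for x' y
      using that le[of x' "[x',x',y,x']"] neq[of "[x',x',y,x']"] by auto
    then show ?thesis unfolding contains_1121 using sub by metis
  qed
  show "avoids_pattern u [1,2,1,1] \<longleftrightarrow>
      avoids_pattern w [1,2,1,1] \<and> (\<forall>y>x. \<not> subseq [x,y,x,x] u)"
  proof -
    have "subseq [x',y,x',x'] w" if "subseq [x',y,x',x'] u" "x' \<noteq> x" "x' < y" for x' y
      using that le[of x' "[x',y,x',x']"] neq[of "[x',y,x',x']"] by auto
    then show ?thesis unfolding contains_1211 using sub by metis
  qed
qed

text \<open>The head may be matched to the first copy of \<open>x\<close>, in gap \<open>p\<close>.
  Behind it stands \<open>drop p w\<close> mixed with copies of \<open>x\<close>, which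
  \<open>s\<close> cannot use.\<close>

lemma subseq_min_insert_letter:
  assumes "x \<notin> set w" "x \<notin> set s" "p \<le> q" "0 < b \<or> p = q \<and> 0 < c"
  shows "subseq (x # s) (insert_letter x b c p q w) \<longleftrightarrow> subseq s (drop p w)"
proof -
  have [simp]: "filter (\<lambda>y. y \<noteq> x) v = v" if "x \<notin> set v" for v
    using that by (auto intro: filter_True)
  obtain v where v: "insert_letter x b c p q w = take p w @ x # v"
    using assms(4) by (cases b; cases c) (auto simp: insert_letter_def)
  have "take p w @ filter (\<lambda>y. y \<noteq> x) v = w"
    using filter_insert_letter[OF assms(1,3), of b c] notin_parts[OF assms(1)] unfolding v by simp
  then have "filter (\<lambda>y. y \<noteq> x) v = drop p w"
    by (metis append_take_drop_id same_append_eq)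
  then show ?thesis
    unfolding v using assms notin_parts[OF assms(1)] subseq_filter_neq[OF assms(2), of v]
    by (simp add: subseq_first_occurrence)
qed

lemma sorted_wrt_drop_iff_no_min:
  fixes x :: nat
  assumes "\<forall>y\<in>set w. x < y" "p \<le> q" "0 < b \<or> p = q \<and> 0 < c" 
  shows "sorted_wrt (\<ge>) (drop p w) \<longleftrightarrow>
      (\<forall>y z. x < y \<and> y < z \<longrightarrow> \<not> subseq [x,y,z] (insert_letter x b c p q w))"
    and "sorted_wrt (\<le>) (drop p w) \<longleftrightarrow>
      (\<forall>y z. x < y \<and> y < z \<longrightarrow> \<not> subseq [x,z,y] (insert_letter x b c p q w))"
proof -
  have x: "x \<notin> set w" using assms(1) by auto
  have less: "x < v" if "subseq s (drop p w)" "v \<in> set s" for s v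
    using that subseq_set_mono[OF that(1)] assms(1) by (meson in_mono in_set_dropD)
  have *: "subseq [x, y, z] (insert_letter x b c p q w) \<longleftrightarrow> subseq [y, z] (drop p w)" if "x \<noteq> y" "x \<noteq> z" for y z
    using that subseq_min_insert_letter[OF x _ assms(2,3), of "[y, z]"] by simp
  show "sorted_wrt (\<ge>) (drop p w) \<longleftrightarrow>
      (\<forall>y z. x < y \<and> y < z \<longrightarrow> \<not> subseq [x,y,z] (insert_letter x b c p q w))"
    unfolding sorted_wrt_iff_subseq using * less[of "[_, _]"]
    by (metis less_irrefl linorder_not_le list.set_intros(1) order.strict_trans)
  show "sorted_wrt (\<le>) (drop p w) \<longleftrightarrow>
      (\<forall>y z. x < y \<and> y < z \<longrightarrow> \<not> subseq [x,z,y] (insert_letter x b c p q w))"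
    unfolding sorted_wrt_iff_subseq using * less[of "[_, _]"]
    by (metis less_irrefl linorder_not_le list.set_intros(1,2) order.strict_trans)
qed

text \<open>This trades the avoidance condition on the inserted word for activity of both gaps; the
  bound \<open>q \<le> n\<close> is recovered from \<open>A\<close>.\<close>

lemma ex_slot_pairs_iff:
  assumes "A \<subseteq> {..n}"
    and "\<And>p q. \<lbrakk>p \<le> q; q \<le> n; a = 1 \<longrightarrow> p = q\<rbrakk> \<Longrightarrow> Q (f p q) \<longleftrightarrow> p \<in> A \<and> q \<in> A"
  shows "Q u \<and> (\<exists>p q. p \<le> q \<and> q \<le> n \<and> (a = 1 \<longrightarrow> p = q) \<and> u = f p q) \<longleftrightarrow>
    (\<exists>p q. (p, q) \<in> slot_pairs A a \<and> u = f p q)"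
  using assms unfolding slot_pairs_def by blast

text \<open>The new active gaps begin just behind the last copy of \<open>x\<close> that has a
  letter of \<open>w\<close> after it. If there is no such copy, they begin at \<open>m\<close> as
  before.\<close>

lemma min_insertion_123:
  "min_insertion (\<lambda>u. avoids_pattern u [1,2,3] \<and> avoids_pattern u [1,1,2,1])
     (suffix_slots (\<ge>)) (\<lambda>a. 1) (\<lambda>a. a - 1)" (is "min_insertion ?Av ?sl _ _")
proof
  show "?Av []"
    by (auto simp: contains_pattern_def)
  show "?sl w \<subseteq> {..length w}" for w
    by (auto simp: suffix_slots_def)
  show "?sl [] = {0}"
    by (auto simp: suffix_slots_def)
next
  fix u w :: "nat list" and x a
  assume *: "\<forall>y\<in>set u. x \<le> y" "x \<in> set u" "w = filter (\<lambda>y. y \<noteq> x) u" "a = count (mset u) x"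
  have less: "\<forall>y\<in>set w. x < y" using *(1,3) by auto
  have "?Av u \<longleftrightarrow> ?Av w \<and> (\<forall>y z. x < y \<and> y < z \<longrightarrow> \<not> subseq [x,y,z] u) \<and>
     (\<exists>p q. p \<le> q \<and> q \<le> length w \<and> (a = 1 \<longrightarrow> p = q) \<and> u = insert_letter x 1 (a - 1) p q w)"
    using avoids_min_iff(1,4)[OF *(1,3)] avoids_1121_iff[OF *(1,2)] *(3,4) by auto
  also have "\<dots> \<longleftrightarrow> ?Av w \<and> (\<exists>p q. (p, q) \<in> slot_pairs (?sl w) a \<and> u = insert_letter x 1 (a - 1) p q w)"
  proof -
    have iff: "(\<forall>y z. x < y \<and> y < z \<longrightarrow> \<not> subseq [x,y,z] (insert_letter x 1 (a - 1) p q w)) \<longleftrightarrow>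
        p \<in> ?sl w \<and> q \<in> ?sl w" if "p \<le> q" "q \<le> length w" "a = 1 \<longrightarrow> p = q" for p q
    proof -
      have "sorted_wrt (\<ge>) (drop p w) \<longleftrightarrow> (\<forall>y z. x < y \<and> y < z \<longrightarrow> \<not> subseq [x,y,z] (insert_letter x 1 (a - 1) p q w))"
        using that by (intro sorted_wrt_drop_iff_no_min(1)[OF less]) auto
      \<comment> \<open>Activity of \<open>p\<close> suffices, since the later gap \<open>q\<close>
        precedes a shorter suffix.\<close>
      then show ?thesis
        using sorted_wrt_drop_mono[of "(\<ge>)" p w q] that by (auto simp: suffix_slots_def)
    qed
    have bound: "?sl w \<subseteq> {..length w}"
      by (auto simp: suffix_slots_def)
    from ex_slot_pairs_iff[where A = "?sl w" and n = "length w" and a = a and u = u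
        and Q = "\<lambda>u. \<forall>y z. x < y \<and> y < z \<longrightarrow> \<not> subseq [x,y,z] u"
        and f = "\<lambda>p q. insert_letter x 1 (a - 1) p q w"]
    have "(\<forall>y z. x < y \<and> y < z \<longrightarrow> \<not> subseq [x,y,z] u) \<and>
        (\<exists>p q. p \<le> q \<and> q \<le> length w \<and> (a = 1 \<longrightarrow> p = q) \<and> u = insert_letter x 1 (a - 1) p q w) \<longleftrightarrow>
        (\<exists>p q. (p, q) \<in> slot_pairs (?sl w) a \<and> u = insert_letter x 1 (a - 1) p q w)"
      using iff bound by blast
    then show ?thesis by blast
  qed
  finally show "?Av u \<longleftrightarrow> ?Av w \<and> (\<exists>p q. (p, q) \<in> slot_pairs (?sl w) a \<and> u = insert_letter x 1 (a - 1) p q w)" .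
next
  fix w :: "nat list" and x a e :: nat
  assume less: "\<forall>y\<in>set w. x < y" and a: "0 < a"
  obtain m where m: "m \<le> length w" "?sl w = {m..length w}"
    "sorted_wrt (\<ge>) (drop m w)" "0 < m \<Longrightarrow> \<not> sorted_wrt (\<ge>) (drop (m - 1) w)"
    using suffix_slots_eq_atLeastAtMost[where R = "(\<ge>)" and w = w] by blast
  let ?n = "length w"
  have "card (?sl (insert_letter x 1 (a - 1) p q w)) - 1 =
      (if q < ?n then ?n - q else if p < ?n then ?n - p + a - 1 else ?n - m + a)"
    if pq: "m \<le> p" "p \<le> q" "q \<le> ?n" "a = 1 \<longrightarrow> p = q" for p q
  proof -
    define u where "u = insert_letter x 1 (a - 1) p q w"
    have len: "length u = ?n + a" using pq a by (simp add: u_def length_insert_letter)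
    have sorted: "sorted_wrt (\<ge>) (drop r w)" if "m \<le> r" for r
      using sorted_wrt_drop_mono[OF m(3) that] .
    have sorted_block: "sorted_wrt (\<ge>) (drop r w @ replicate k x)" if "m \<le> r" for r k
    proof -
      have "sorted_wrt (\<ge>) (replicate k x)" by (induction k) auto
      with sorted[OF that] less show ?thesis
        by (auto simp: sorted_wrt_append dest!: in_set_dropD intro: less_imp_le)
    qed
    consider "q < ?n" | "q = ?n" "p < ?n" | "q = ?n" "p = ?n" using pq by linarith
    then show ?thesis
    proof cases
      case 1
      \<comment> \<open>Whether or not the gaps coincide, a copy of \<open>x\<close> stands directly
        before \<open>drop q w\<close>, at position \<open>q + a - 1\<close>.\<close>
      obtain v where v: "u = v @ x # drop q w" "length v = q + a - 1"
      proof (cases "p = q")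
        case True
        then show thesis using that[of "take p w @ replicate (a - 1) x"] a pq
          by (cases a) (auto simp: u_def insert_letter_def replicate_app_Cons_same)
      next
        case False
        \<comment> \<open>Distinct gaps exclude \<open>a = 1\<close>, so the second block is
          nonempty.\<close>
        then obtain k where "a = Suc (Suc k)" using pq a by (metis One_nat_def Suc_pred gr0_conv_Suc neq0_conv)
        then show thesis using that[of "take p w @ x # take (q - p) (drop p w) @ replicate k x"] pq
          by (auto simp: u_def insert_letter_def replicate_app_Cons_same)
      qed
      have "w ! q > x" using less 1 by simp
      then have "\<not> sorted_wrt (\<ge>) (x # drop q w)"
        using 1 by (simp add: Cons_nth_drop_Suc[symmetric] )
      then have "?sl u = {q + a..length u}"
        using v a sorted pq by (intro suffix_slots_eq_atLeastAtMostI) auto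
      with len 1 show ?thesis by (simp add: u_def)
    next
      case 2
      have u: "u = take p w @ x # drop p w @ replicate (a - 1) x"
        using 2 by (simp add: u_def insert_letter_def)
      have "w ! p > x" using less 2 by simp
      then have "\<not> sorted_wrt (\<ge>) (x # drop p w @ replicate (a - 1) x)"
        using 2 by (simp add: Cons_nth_drop_Suc[symmetric])
      then have "?sl u = {p + 1..length u}"
        using u pq sorted_block[OF pq(1), of "a - 1"] by (intro suffix_slots_eq_atLeastAtMostI) auto
      with len 2 a show ?thesis by (simp add: u_def)
    next
      case 3
      have u: "u = w @ replicate a x"
        using 3 a by (cases a) (simp_all add: u_def insert_letter_def)
      have "?sl u = {m..length u}"
        using u m sorted_block[of m a] by (intro suffix_slots_eq_atLeastAtMostI) (auto simp: sorted_wrt_append)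
      with len 3 m(1) show ?thesis by (simp add: u_def)
    qed
  qed
  then have "{(p, q) \<in> slot_pairs (?sl w) a. card (?sl (insert_letter x 1 (a - 1) p q w)) - 1 = e} =
     {(p, q). m \<le> p \<and> p \<le> q \<and> q \<le> ?n \<and> (a = 1 \<longrightarrow> p = q) \<and>
      (if q < ?n then ?n - q else if p < ?n then ?n - p + a - 1 else ?n - m + a) = e}"
    by (auto simp: slot_pairs_def m(2) simp del: One_nat_def)
  with slot_count_weakly_decreasing[OF m(1) a, of e]
  show "card {(p, q) \<in> slot_pairs (?sl w) a. card (?sl (insert_letter x 1 (a - 1) p q w)) - 1 = e} =
      slot_count a (card (?sl w) - 1) e"
    using m(2) by simp
qed (auto)

text \<open>For \<open>p < q\<close> the active gaps begin right before the last copy of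
  \<open>x\<close>, because the letter of \<open>w\<close> in front of it is larger. For
  \<open>p = q\<close> they begin before the whole block of copies.\<close>

lemma min_insertion_132:
  "min_insertion (\<lambda>u. avoids_pattern u [1,3,2] \<and> avoids_pattern u [1,2,1,1])
     (suffix_slots (\<le>)) (\<lambda>a. a - 1) (\<lambda>a. 1)" (is "min_insertion ?Av ?sl _ _")
proof
  show "?Av []"
    by (auto simp: contains_pattern_def)
  show "?sl w \<subseteq> {..length w}" for w
    by (auto simp: suffix_slots_def)
  show "?sl [] = {0}"
    by (auto simp: suffix_slots_def)
next
  fix u w :: "nat list" and x a
  assume *: "\<forall>y\<in>set u. x \<le> y" "x \<in> set u" "w = filter (\<lambda>y. y \<noteq> x) u" "a = count (mset u) x"
  have less: "\<forall>y\<in>set w. x < y" using *(1,3) by auto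
  have a: "0 < a" using *(2,4) by simp
  have "?Av u \<longleftrightarrow> ?Av w \<and> (\<forall>y z. x < y \<and> y < z \<longrightarrow> \<not> subseq [x,z,y] u) \<and>
     (\<exists>p q. p \<le> q \<and> q \<le> length w \<and> (a = 1 \<longrightarrow> p = q) \<and> u = insert_letter x (a - 1) 1 p q w)"
    using avoids_min_iff(2,5)[OF *(1,3)] avoids_1211_iff[OF *(1,2)] *(3,4) by auto
  also have "\<dots> \<longleftrightarrow> ?Av w \<and> (\<exists>p q. (p, q) \<in> slot_pairs (?sl w) a \<and> u = insert_letter x (a - 1) 1 p q w)"
  proof -
    have iff: "(\<forall>y z. x < y \<and> y < z \<longrightarrow> \<not> subseq [x,z,y] (insert_letter x (a - 1) 1 p q w)) \<longleftrightarrow>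
        p \<in> ?sl w \<and> q \<in> ?sl w" if "p \<le> q" "q \<le> length w" "a = 1 \<longrightarrow> p = q" for p q
    proof -
      have "sorted_wrt (\<le>) (drop p w) \<longleftrightarrow> (\<forall>y z. x < y \<and> y < z \<longrightarrow> \<not> subseq [x,z,y] (insert_letter x (a - 1) 1 p q w))"
        using that a by (intro sorted_wrt_drop_iff_no_min(2)[OF less]) auto
      then show ?thesis
        using sorted_wrt_drop_mono[of "(\<le>)" p w q] that by (auto simp: suffix_slots_def)
    qed
    have bound: "?sl w \<subseteq> {..length w}"
      by (auto simp: suffix_slots_def)
    from ex_slot_pairs_iff[where A = "?sl w" and n = "length w" and a = a and u = u
        and Q = "\<lambda>u. \<forall>y z. x < y \<and> y < z \<longrightarrow> \<not> subseq [x,z,y] u"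
        and f = "\<lambda>p q. insert_letter x (a - 1) 1 p q w"]
    have "(\<forall>y z. x < y \<and> y < z \<longrightarrow> \<not> subseq [x,z,y] u) \<and>
        (\<exists>p q. p \<le> q \<and> q \<le> length w \<and> (a = 1 \<longrightarrow> p = q) \<and> u = insert_letter x (a - 1) 1 p q w) \<longleftrightarrow>
        (\<exists>p q. (p, q) \<in> slot_pairs (?sl w) a \<and> u = insert_letter x (a - 1) 1 p q w)"
      using iff bound by blast
    then show ?thesis by blast
  qed
  finally show "?Av u \<longleftrightarrow> ?Av w \<and> (\<exists>p q. (p, q) \<in> slot_pairs (?sl w) a \<and> u = insert_letter x (a - 1) 1 p q w)" .
next
  fix w :: "nat list" and x a e :: nat
  assume less: "\<forall>y\<in>set w. x < y" and a: "0 < a"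
  obtain m where m: "m \<le> length w" "?sl w = {m..length w}"
    "sorted_wrt (\<le>) (drop m w)" "0 < m \<Longrightarrow> \<not> sorted_wrt (\<le>) (drop (m - 1) w)"
    using suffix_slots_eq_atLeastAtMost[where R = "(\<le>)" and w = w] by blast
  let ?n = "length w"
  have "card (?sl (insert_letter x (a - 1) 1 p q w)) - 1 = (if p < q then ?n - q + 1 else ?n - p + a)"
    if pq: "m \<le> p" "p \<le> q" "q \<le> ?n" "a = 1 \<longrightarrow> p = q" for p q
  proof -
    define u where "u = insert_letter x (a - 1) 1 p q w"
    have len: "length u = ?n + a" using pq a by (simp add: u_def length_insert_letter)
    have sorted: "sorted_wrt (\<le>) (replicate k x @ drop r w)" if "m \<le> r" for r k
      using sorted_wrt_drop_mono[OF m(3) that] less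
      by (induction k) (auto dest!: in_set_dropD intro: less_imp_le)
    show ?thesis
    proof (cases "p < q")
      case True
      then obtain k where k: "q = Suc (p + k)" using less_iff_Suc_add by auto
      \<comment> \<open>The last letter of the middle part is singled out: it is the larger letter
        directly before the copy in gap \<open>q\<close>.\<close>
      have "take (q - p) (drop p w) = take k (drop p w) @ [w ! (q - 1)]"
        using k pq by (simp add: take_Suc_conv_app_nth Suc_diff_le)
      then obtain v where v: "u = v @ w ! (q - 1) # x # drop q w" "length v = q + a - 2"
        using that[of "take p w @ replicate (a - 1) x @ take k (drop p w)"] pq k a
        by (auto simp: u_def insert_letter_def)
      have "x < w ! (q - 1)" using less True pq by simp
      moreover have "drop (q + a - 1) u = x # drop q w" "drop (q + a - 1 - 1) u = w ! (q - 1) # x # drop q w"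
        using v True a by (simp_all add: Suc_diff_le numeral_2_eq_2)
      ultimately have "?sl u = {q + a - 1..length u}"
        using sorted[of q 1] pq by (intro suffix_slots_eq_atLeastAtMostI) auto
      with len True pq a show ?thesis by (simp add: u_def)
    next
      case False
      have u: "u = take p w @ replicate a x @ drop p w"
        using False pq a by (cases a) (simp_all add: u_def insert_letter_def replicate_app_Cons_same)
      have "?sl u = {p..length u}"
      proof (rule suffix_slots_eq_atLeastAtMostI)
        show "sorted_wrt (\<le>) (drop p u)"
          using sorted[OF pq(1)] u pq by simp
        show "\<not> sorted_wrt (\<le>) (drop (p - 1) u)" if "0 < p"
        proof -
          have "drop (p - 1) (take p w) = [w ! (p - 1)]"
            using that pq by (cases p) (auto simp: take_Suc_conv_app_nth)
          then have "drop (p - 1) u = w ! (p - 1) # replicate a x @ drop p w"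
            using u pq by simp
          moreover have "x < w ! (p - 1)" using less that pq by simp
          ultimately show ?thesis using a by auto
        qed
      qed
      with len False pq show ?thesis by (simp add: u_def)
    qed
  qed
  then have "{(p, q) \<in> slot_pairs (?sl w) a. card (?sl (insert_letter x (a - 1) 1 p q w)) - 1 = e} =
     {(p, q). m \<le> p \<and> p \<le> q \<and> q \<le> ?n \<and> (a = 1 \<longrightarrow> p = q) \<and>
      (if p < q then ?n - q + 1 else ?n - p + a) = e}"
    by (auto simp: slot_pairs_def m(2) simp del: One_nat_def)
  with slot_count_weakly_increasing[OF m(1) a, of e]
  show "card {(p, q) \<in> slot_pairs (?sl w) a. card (?sl (insert_letter x (a - 1) 1 p q w)) - 1 = e} =
      slot_count a (card (?sl w) - 1) e"
    using m(2) by simp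
qed (auto)

text \<open>The active gaps for \<open>213\<close> need not form an interval, so pairs are compared
  through ranks, an order isomorphism onto \<open>{..card A - 1}\<close> that gives the end gap
  \<open>n\<close> the top rank.\<close>

lemma slot_count_rank:
  assumes fin: "finite A" and n: "n \<in> A" "\<forall>r\<in>A. r \<le> n"
  shows "card {(p, q) \<in> slot_pairs A a. (if q < n then card {r \<in> A. r < p} + 1 else card {r \<in> A. r < p} + a) = e} =
    slot_count a (card A - 1) e"
proof -
  define rk where "rk p = card {r \<in> A. r < p}" for p
  have less: "rk p < rk q" if "p \<in> A" "p < q" for p q
    unfolding rk_def using that fin by (intro psubset_card_mono) auto
  have inj: "inj_on rk A"
    using less by (intro inj_onI) (metis less_irrefl linorder_neqE_nat)
  have "A - {n} = {r \<in> A. r < n}" using n(2) by (auto simp: le_neq_implies_less)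
  then have rk_n: "rk n = card A - 1" using n(1) by (metis card_Diff_singleton rk_def)
  have le: "rk p \<le> rk q \<longleftrightarrow> p \<le> q" if "p \<in> A" "q \<in> A" for p q
    using less[of p q] less[of q p] that by (cases p q rule: linorder_cases) auto
  have pos: "0 < card A" using fin n(1) card_gt_0_iff by blast
  have "rk p \<le> card A - 1" if "p \<in> A" for p
    using le[OF that n(1)] n(2) that rk_n by simp
  then have "rk ` A \<subseteq> {..card A - 1}"
    by blast
  moreover have "card (rk ` A) = card {..card A - 1}"
    using card_image[OF inj] pos by simp
  ultimately have img: "rk ` A = {..card A - 1}"
    by (intro card_subset_eq) auto
  have eq: "rk p = rk q \<longleftrightarrow> p = q" if "p \<in> A" "q \<in> A" for p q
    using inj that by (auto dest: inj_onD)
  have lt: "rk q < card A - 1 \<longleftrightarrow> q < n" if "q \<in> A" for q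
    using le[OF n(1) that] rk_n by linarith
  let ?S = "{(p, q) \<in> slot_pairs A a. (if q < n then rk p + 1 else rk p + a) = e}"
  let ?T = "{(g, h). g \<le> h \<and> h \<le> card A - 1 \<and> (a = 1 \<longrightarrow> g = h) \<and> (if h < card A - 1 then Suc g else g + a) = e}"
  have "bij_betw (map_prod rk rk) ?S ?T"
  proof (rule bij_betw_imageI)
    show "inj_on (map_prod rk rk) ?S"
      using eq by (auto simp: inj_on_def slot_pairs_def)
    show "map_prod rk rk ` ?S = ?T"
    proof (intro equalityI subsetI)
      fix t assume "t \<in> map_prod rk rk ` ?S"
      then obtain p q where pq: "t = (rk p, rk q)" "(p, q) \<in> ?S" by auto
      then have "p \<in> A" "q \<in> A" by (auto simp: slot_pairs_def)
      then have "rk p \<le> rk q \<longleftrightarrow> p \<le> q" "rk q < card A - 1 \<longleftrightarrow> q < n" "rk q \<le> card A - 1"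
        using le lt img by blast+
      with pq show "t \<in> ?T" by (auto simp: slot_pairs_def split: if_splits)
    next
      fix t assume t: "t \<in> ?T"
      obtain g h where gh: "t = (g, h)" by force
      with t have "g \<in> rk ` A" "h \<in> rk ` A" unfolding img by auto
      then obtain p q where "p \<in> A" "q \<in> A" "g = rk p" "h = rk q" by blast
      then have "(p, q) \<in> ?S" "t = map_prod rk rk (p, q)"
        using t le[of p q] lt[of q] eq[of p q] gh by (auto simp: slot_pairs_def split: if_splits)
      then show "t \<in> map_prod rk rk ` ?S" by blast
    qed
  qed
  from bij_betw_same_card[OF this] show ?thesis unfolding slot_count_def rk_def .
qed

section \<open>Gaps crossed by no increasing pair\<close>

definition descent_slots :: "nat list \<Rightarrow> nat set" where
  "descent_slots w = {p. p \<le> length w \<and> (\<forall>y\<in>set (take p w). \<forall>z\<in>set (drop p w). z \<le> y)}"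

text \<open>The \<open>x\<close> of an occurrence lies in gap \<open>p\<close> or \<open>q\<close>,
  with \<open>y\<close> and \<open>z\<close> on the two sides of that gap. Conversely, an increasing
  pair across either gap encloses a copy of \<open>x\<close>.\<close>

lemma descent_slots_iff_no_min:
  assumes less: "\<forall>y\<in>set w. x < y" and pq: "p \<le> q" "q \<le> length w" "a = 1 \<longrightarrow> p = q" "0 < a"
  defines "u \<equiv> insert_letter x 1 (a - 1) p q w"
  shows "p \<in> descent_slots w \<and> q \<in> descent_slots w \<longleftrightarrow>
    (\<forall>y z. x < y \<and> y < z \<longrightarrow> \<not> subseq [y, x, z] u)"
proof
  have x: "x \<notin> set w" using less by auto
  note parts = notin_parts[OF x]
  define w2 where "w2 = take (q - p) (drop p w)"
  have x_w2: "x \<notin> set w2" using parts by (simp add: w2_def)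
  have u: "u = take p w @ x # w2 @ replicate (a - 1) x @ drop q w"
    by (simp add: u_def w2_def insert_letter_def)
  have sets: "set (take q w) = set (take p w) \<union> set w2" "set (drop p w) = set w2 \<union> set (drop q w)"
    using set_take_le[OF pq(1)] set_drop_le[OF pq(1)] by (simp_all add: w2_def)
  {
    assume A: "p \<in> descent_slots w \<and> q \<in> descent_slots w"
    show "\<forall>y z. x < y \<and> y < z \<longrightarrow> \<not> subseq [y, x, z] u"
    proof (intro allI impI notI)
      fix y z assume yz: "x < y \<and> y < z" and "subseq [y, x, z] u"
      then consider "y \<in> set (take p w)" "z \<in> set (w2 @ replicate (a - 1) x @ drop q w)"
        | "subseq [y, x, z] (w2 @ replicate (a - 1) x @ drop q w)"
        using subseq3_append_notin[of x "take p w" y z "x # w2 @ replicate (a - 1) x @ drop q w"] parts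
        by (auto simp: u subseq_singleton_left)
      then show False
      proof cases
        case 1
        then have "z \<in> set (drop p w)" using yz sets by auto
        with 1 A have "z \<le> y" unfolding descent_slots_def by blast
        with yz show False by simp
      next
        case 2
        then have "y \<in> set w2 \<and> subseq [x, z] (replicate (a - 1) x @ drop q w) \<or>
            subseq [y, x, z] (replicate (a - 1) x @ drop q w)"
          using subseq3_append_notin[of x w2] x_w2 by blast
        \<comment> \<open>From the second block on, no larger letter is followed by
          \<open>x\<close>.\<close>
        moreover have "\<not> subseq [y, x, z] (replicate (a - 1) x @ drop q w)"
        proof
          assume "subseq [y, x, z] (replicate (a - 1) x @ drop q w)"
          moreover have "subseq [y, x] [y, x, z]" by simp
          ultimately have "subseq [y, x] (replicate (a - 1) x @ drop q w)"
            using subseq_order.order_trans by blast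
          then show False using not_subseq_block[of x y "drop q w" "a - 1"] parts yz by blast
        qed
        ultimately have "y \<in> set w2" "z \<in> set (drop q w)"
          using yz subseq_set_mono[of "[x, z]" "replicate (a - 1) x @ drop q w"] by auto
        with A sets have "z \<le> y" unfolding descent_slots_def by blast
        with yz show False by simp
      qed
    qed
  next
    assume B: "\<forall>y z. x < y \<and> y < z \<longrightarrow> \<not> subseq [y, x, z] u"
    have gt: "x < y" if "y \<in> set (take r w)" for y r
      using that less in_set_takeD by fast
    have 1: "p \<in> descent_slots w"
    proof -
      have "z \<le> y" if "y \<in> set (take p w)" "z \<in> set (drop p w)" for y z
      proof -
        have "subseq [y, x, z] u"
          unfolding subseq3_iff u using that sets by (intro exI conjI) (rule refl, auto)
        with B gt that show ?thesis by (metis not_le)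
      qed
      with pq show ?thesis by (auto simp: descent_slots_def)
    qed
    moreover have "q \<in> descent_slots w"
    proof (cases "p = q")
      case False
      \<comment> \<open>Distinct gaps mean at least two copies; the last one, in gap
        \<open>q\<close>, is isolated as the middle letter.\<close>
      then obtain k where k: "a - 1 = Suc k" using pq by (cases "a - 1") auto
      have u': "u = (take p w @ x # w2 @ replicate k x) @ x # drop q w"
        unfolding u k by (simp add: replicate_app_Cons_same)
      have "z \<le> y" if "y \<in> set (take q w)" "z \<in> set (drop q w)" for y z
      proof -
        have "subseq [y, x, z] u"
          unfolding subseq3_iff u' using that sets by (intro exI conjI) (rule refl, auto)
        with B gt that show ?thesis by (metis not_le)
      qed
      with pq show ?thesis by (auto simp: descent_slots_def)
    qed (use 1 in simp)
    ultimately show "p \<in> descent_slots w \<and> q \<in> descent_slots w" ..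
  }
qed

text \<open>A gap up to \<open>p\<close> gains only copies of the minimum behind it and keeps its
  status. A gap beyond \<open>p\<close> has \<open>x\<close> before it, so it is active exactly when
  nothing but \<open>x\<close> follows: only the end gap for \<open>q < n\<close>, and the last
  \<open>a\<close> gaps for \<open>q = n\<close>.\<close>

lemma descent_slots_insert_min:
  assumes less: "\<forall>y\<in>set w. x < y" and pq: "p \<le> q" "q \<le> length w" and a: "0 < a" "a = 1 \<longrightarrow> p = q"
  defines "n \<equiv> length w"
  shows "descent_slots (insert_letter x 1 (a - 1) p q w) =
    {r \<in> descent_slots w. r \<le> p} \<union> (if q < n then {n + a} else {n + 1..n + a})"
proof -
  define u where "u = insert_letter x 1 (a - 1) p q w"
  define v where "v = take (q - p) (drop p w) @ replicate (a - 1) x @ drop q w"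
  have u: "u = take p w @ x # v"
    by (simp add: u_def v_def insert_letter_def)
  have len: "length u = n + a" using pq a by (simp add: u_def n_def length_insert_letter)
  have "set u = set_mset (mset u)" by simp
  also have "\<dots> = insert x (set w)" using pq a by (auto simp: u_def mset_insert_letter)
  finally have set_u: "set u = insert x (set w)" .
  have set_v: "set v \<union> {x} = set (drop p w) \<union> {x}"
    using set_drop_le[OF pq(1), of w] by (auto simp: v_def)
  have low: "r \<in> descent_slots u \<longleftrightarrow> r \<in> descent_slots w" if "r \<le> p" for r
  proof -
    have 1: "take r u = take r w" using that pq u by (simp add: min_absorb1)
    have "set (drop r u) = set (drop r (take p w)) \<union> {x} \<union> set (drop p w)"
      using that pq u set_v by auto
    also have "\<dots> = insert x (set (drop r w))"
      using set_drop_le[OF that, of w] by (auto simp: drop_take)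
    finally have 2: "set (drop r u) = insert x (set (drop r w))" .
    have "x \<le> y" if "y \<in> set (take r w)" for y
      using that less in_set_takeD by (fastforce intro: less_imp_le)
    then show ?thesis using 1 2 that pq len n_def by (auto simp: descent_slots_def)
  qed
  have high: "r \<in> descent_slots u \<longleftrightarrow> r \<le> n + a \<and> set (drop r u) \<subseteq> {x}" if "p < r" for r
  proof -
    have "x \<in> set (take r u)"
      using that pq unfolding u by (cases "r - p") (auto simp: take_Cons')
    moreover have "x \<le> y" if "y \<in> set (take r u)" for y
      using in_set_takeD[OF that] set_u less by (auto intro: less_imp_le)
    moreover have "x \<le> y" if "y \<in> set (drop r u)" for y
      using in_set_dropD[OF that] set_u less by (auto intro: less_imp_le)
    ultimately show ?thesis
      using len by (fastforce simp: descent_slots_def)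
  qed
  have high': "r \<in> descent_slots u \<longleftrightarrow> r \<in> (if q < n then {n + a} else {n + 1..n + a})" if r: "p < r" for r
  proof (cases "q < n")
    case True
    \<comment> \<open>For \<open>q < n\<close> the last letter of \<open>w\<close> still ends
      \<open>u\<close>, so every nonempty suffix contains a letter above \<open>x\<close>.\<close>
    have "last w \<in> set w" using True by (intro last_in_set) (auto simp: n_def)
    then have "x < last u"
      using True less pq by (auto simp: u_def insert_letter_def n_def last_drop)
    have "r = n + a" if "r \<le> n + a" "set (drop r u) \<subseteq> {x}"
    proof (rule ccontr)
      assume "r \<noteq> n + a"
      then have "drop r u \<noteq> []" "last (drop r u) = last u" using that(1) len by (auto simp: last_drop)
      then have "last u \<in> set (drop r u)" by (metis last_in_set)
      with that(2) \<open>x < last u\<close> show False by auto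
    qed
    then show ?thesis using high[OF r] True len by auto
  next
    case False
    then have q: "q = n" using pq n_def by simp
    have u': "u = take p w @ x # drop p w @ replicate (a - 1) x"
      using q by (simp add: u v_def n_def)
    \<comment> \<open>Beyond gap \<open>p\<close> the first copy of \<open>x\<close> shifts
      positions by one, which explains the \<open>Suc\<close>.\<close>
    have drop_u: "drop r u = drop (r - Suc p) (drop p w) @ drop (r - Suc n) (replicate (a - 1) x)"
    proof -
      obtain k where "r = Suc (p + k)" using r less_iff_Suc_add by blast
      then show ?thesis using pq q unfolding u' by (simp add: n_def add.commute)
    qed
    have "set (drop r u) \<subseteq> {x} \<longleftrightarrow> n + 1 \<le> r"
    proof
      assume sub: "set (drop r u) \<subseteq> {x}"
      show "n + 1 \<le> r"
      proof (rule ccontr)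
        assume "\<not> n + 1 \<le> r"
        then have "drop (r - 1) w \<noteq> []" "drop (r - Suc p) (drop p w) = drop (r - 1) w"
          using r by (auto simp: n_def)
        then obtain y where "y \<in> set (drop (r - 1) w)" "y \<in> set (drop r u)"
          using drop_u by (metis Un_iff last_in_set set_append)
        with sub less show False by (metis in_mono in_set_dropD less_irrefl singletonD)
      qed
    next
      assume "n + 1 \<le> r"
      then show "set (drop r u) \<subseteq> {x}" using r unfolding drop_u n_def by (auto dest: in_set_dropD)
    qed
    then show ?thesis using high[OF r] False by auto
  qed
  \<comment> \<open>All new gaps lie beyond \<open>p\<close>, so the two descriptions do not
    interfere.\<close>
  have "\<not> p \<ge> r" if "r \<in> (if q < n then {n + a} else {n + 1..n + a})" for r
    using that pq a by (auto simp: n_def split: if_splits)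
  then have "r \<in> descent_slots u \<longleftrightarrow>
      r \<in> {r \<in> descent_slots w. r \<le> p} \<union> (if q < n then {n + a} else {n + 1..n + a})" for r
    using low[of r] high'[of r] by (cases "r \<le> p") (blast, simp add: not_le)
  then show ?thesis unfolding u_def by blast
qed

text \<open>As \<open>p\<close> is active, \<open>?rk p + 1\<close> old gaps survive, and one or
  \<open>a\<close> new gaps join them. Subtracting one gives the rule in \<open>slot_count\<close>
  with \<open>p\<close> replaced by its rank.\<close>

lemma min_insertion_213:
  "min_insertion (\<lambda>u. avoids_pattern u [2,1,3] \<and> avoids_pattern u [1,1,2,1])
     descent_slots (\<lambda>a. 1) (\<lambda>a. a - 1)" (is "min_insertion ?Av ?sl _ _")
proof
  show "?Av []"
    by (auto simp: contains_pattern_def)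
  show "?sl w \<subseteq> {..length w}" for w
    by (auto simp: descent_slots_def)
  show "?sl [] = {0}"
    by (auto simp: descent_slots_def)
next
  fix u w :: "nat list" and x a
  assume *: "\<forall>y\<in>set u. x \<le> y" "x \<in> set u" "w = filter (\<lambda>y. y \<noteq> x) u" "a = count (mset u) x"
  have less: "\<forall>y\<in>set w. x < y" using *(1,3) by auto
  have a: "0 < a" using *(2,4) by simp
  have "?Av u \<longleftrightarrow> ?Av w \<and> (\<forall>y z. x < y \<and> y < z \<longrightarrow> \<not> subseq [y,x,z] u) \<and>
     (\<exists>p q. p \<le> q \<and> q \<le> length w \<and> (a = 1 \<longrightarrow> p = q) \<and> u = insert_letter x 1 (a - 1) p q w)"
    using avoids_min_iff(3,4)[OF *(1,3)] avoids_1121_iff[OF *(1,2)] *(3,4) by auto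
  also have "\<dots> \<longleftrightarrow> ?Av w \<and> (\<exists>p q. (p, q) \<in> slot_pairs (?sl w) a \<and> u = insert_letter x 1 (a - 1) p q w)"
  proof -
    have iff: "(\<forall>y z. x < y \<and> y < z \<longrightarrow> \<not> subseq [y,x,z] (insert_letter x 1 (a - 1) p q w)) \<longleftrightarrow>
        p \<in> ?sl w \<and> q \<in> ?sl w" if "p \<le> q" "q \<le> length w" "a = 1 \<longrightarrow> p = q" for p q
      using descent_slots_iff_no_min[OF less that a] by blast
    have bound: "?sl w \<subseteq> {..length w}"
      by (auto simp: descent_slots_def)
    from ex_slot_pairs_iff[where A = "?sl w" and n = "length w" and a = a and u = u
        and Q = "\<lambda>u. \<forall>y z. x < y \<and> y < z \<longrightarrow> \<not> subseq [y,x,z] u"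
        and f = "\<lambda>p q. insert_letter x 1 (a - 1) p q w"]
    have "(\<forall>y z. x < y \<and> y < z \<longrightarrow> \<not> subseq [y,x,z] u) \<and>
        (\<exists>p q. p \<le> q \<and> q \<le> length w \<and> (a = 1 \<longrightarrow> p = q) \<and> u = insert_letter x 1 (a - 1) p q w) \<longleftrightarrow>
        (\<exists>p q. (p, q) \<in> slot_pairs (?sl w) a \<and> u = insert_letter x 1 (a - 1) p q w)"
      using iff bound by blast
    then show ?thesis by blast
  qed
  finally show "?Av u \<longleftrightarrow> ?Av w \<and> (\<exists>p q. (p, q) \<in> slot_pairs (?sl w) a \<and> u = insert_letter x 1 (a - 1) p q w)" .
next
  fix w :: "nat list" and x a e :: nat
  assume less: "\<forall>y\<in>set w. x < y" and a: "0 < a"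
  let ?n = "length w"
  let ?rk = "\<lambda>p. card {r \<in> ?sl w. r < p}"
  have fin: "finite (?sl w)"
    by (rule finite_subset[of _ "{..?n}"]) (auto simp: descent_slots_def)
  have card_child: "card (?sl (insert_letter x 1 (a - 1) p q w)) - 1 = (if q < ?n then ?rk p + 1 else ?rk p + a)"
    if pq: "p \<in> ?sl w" "p \<le> q" "q \<le> ?n" "a = 1 \<longrightarrow> p = q" for p q
  proof -
    let ?B = "if q < ?n then {?n + a} else {?n + 1..?n + a}"
    have "{r \<in> ?sl w. r \<le> p} = insert p {r \<in> ?sl w. r < p}"
      using pq(1) by auto
    then have "card {r \<in> ?sl w. r \<le> p} = ?rk p + 1" using fin by simp
    moreover have "card ({r \<in> ?sl w. r \<le> p} \<union> ?B) = card {r \<in> ?sl w. r \<le> p} + card ?B"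
      using pq fin a by (intro card_Un_disjoint) auto
    ultimately show ?thesis
      using descent_slots_insert_min[OF less pq(2,3) a pq(4)] by simp
  qed
  have le: "r \<le> ?n" if "r \<in> ?sl w" for r using that by (simp add: descent_slots_def)
  have "{(p, q) \<in> slot_pairs (?sl w) a. card (?sl (insert_letter x 1 (a - 1) p q w)) - 1 = e} =
     {(p, q) \<in> slot_pairs (?sl w) a. (if q < ?n then ?rk p + 1 else ?rk p + a) = e}"
    using card_child le by (auto simp: slot_pairs_def simp del: One_nat_def)
  moreover have "?n \<in> ?sl w" by (simp add: descent_slots_def)
  ultimately show "card {(p, q) \<in> slot_pairs (?sl w) a. card (?sl (insert_letter x 1 (a - 1) p q w)) - 1 = e} =
      slot_count a (card (?sl w) - 1) e"
    using slot_count_rank[OF fin, of ?n a e] le by simp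
qed (auto)

theorem theorem2p17:
  shows "{[1,2,3], [1,1,2,1]} \<sim>\<^sub>m {[1,3,2], [1,2,1,1]} \<and>
         {[1,3,2], [1,2,1,1]} \<sim>\<^sub>m {[2,1,3], [1,1,2,1]} \<and>
         {[1,2,3], [1,1,2,1]} \<sim>\<^sub>m {[2,1,3], [1,1,2,1]}"
proof -
  \<comment> \<open>Each \<open>av\<close> is the number of words in the corresponding tree, so the
    pairwise comparison of trees applies.\<close>
  have av: "av S {\<rho>, \<sigma>} = card (min_insertion.avoiders (\<lambda>u. avoids_pattern u \<rho> \<and> avoids_pattern u \<sigma>) S)"
    if "min_insertion (\<lambda>u. avoids_pattern u \<rho> \<and> avoids_pattern u \<sigma>) sl b c" for S \<rho> \<sigma> sl b c
    using min_insertion.avoiders_def[OF that] by (simp add: av_def)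
  show ?thesis
    unfolding m_equivalent_def
      av[OF min_insertion_123] av[OF min_insertion_132] av[OF min_insertion_213]
    using min_insertion_card_avoiders_eq min_insertion_123 min_insertion_132 min_insertion_213
    by blast
qed

end
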